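(* Let $t\ge 1$ be an integer. For every real $\varepsilon>0$ there is an integer $N_{\varepsilon,t}$ such that Player 1 has a strategy in the $(1:t)$ biased binary sequence game which ensures that any two adjacent blocks, both of the same length $n>N_{\varepsilon,t}$, in the resulting infinite sequence differ in at least $\left(\frac{1}{2t+2}-\varepsilon\right)n$ places. That is, whatever Player 2 does, the resulting sequence $\alpha_1\alpha_2\alpha_3\dots$ has the property that for all integers $k\ge 0$ and $n>N_{\varepsilon,t}$, one has $\alpha_{k+j}\ne\alpha_{k+n+j}$ for at least $\left(\frac{1}{2t+2}-\varepsilon\right)n$ values of $j\in\{1,\dots,n\}$.
   Context: The $(1:t)$ biased binary sequence game: two players choose digits from $\{0,1\}$ one after another, forming an unending sequence $\alpha_1\alpha_2\alpha_3\dots$. Player 1 chooses $\alpha_j$ for $j\equiv 1\pmod{t+1}$, and Player 2 chooses all other terms (so Player 2 makes $t$ moves between consecutive moves of Player 1); each choice is made with full knowledge of all previous choices. A strategy for Player 1 is a function assigning to each finite history ending just before a move of Player 1 the digit he plays. It ensures a property if every infinite sequence resulting from play in which Player 1 follows the strategy (with arbitrary moves by Player 2) has that property. *)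

theory Defs
  imports Complex_Main "HOL-Number_Theory.Cong"
begin

text \<open>
  The two digits 0, 1 are the booleans \<open>False\<close>, \<open>True\<close>.  A play
  \<open>\<alpha>\<^sub>1 \<alpha>\<^sub>2 \<alpha>\<^sub>3 \<dots>\<close> is a function \<open>\<alpha> :: nat \<Rightarrow> bool\<close> used at positive
  indices only; the value \<open>\<alpha> 0\<close> has no meaning and is never inspected.
\<close>

definition player1_move :: "nat \<Rightarrow> nat \<Rightarrow> bool" where
  "player1_move t j \<longleftrightarrow> j \<ge> 1 \<and> [j = 1] (mod (t + 1))"

definition history :: "(nat \<Rightarrow> bool) \<Rightarrow> nat \<Rightarrow> bool list" where
  "history \<alpha> j = map \<alpha> [1..<j]"

text \<open>
  A strategy for Player 1 is a function on finite histories.  It is total on lists for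
  convenience: only its values at histories \<open>\<alpha>\<^sub>1 \<dots> \<alpha>\<^bsub>j-1\<^esub>\<close> with \<open>j\<close> a move of
  Player 1 are ever used.
\<close>

type_synonym strategy = "bool list \<Rightarrow> bool"

definition follows :: "nat \<Rightarrow> strategy \<Rightarrow> (nat \<Rightarrow> bool) \<Rightarrow> bool" where
  "follows t \<sigma> \<alpha> \<longleftrightarrow> (\<forall>j. player1_move t j \<longrightarrow> \<alpha> j = \<sigma> (history \<alpha> j))"

text \<open>
  The moves of Player 2 are unrestricted, so the sequences that can result when Player 1
  plays \<open>\<sigma>\<close> are exactly those that follow \<open>\<sigma>\<close>.
\<close>

definition ensures :: "nat \<Rightarrow> strategy \<Rightarrow> ((nat \<Rightarrow> bool) \<Rightarrow> bool) \<Rightarrow> bool" where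
  "ensures t \<sigma> P \<longleftrightarrow> (\<forall>\<alpha>. follows t \<sigma> \<alpha> \<longrightarrow> P \<alpha>)"

end

theory Submission
  imports Defs
begin

text \<open>
  If Player 1 could not survive \<open>M\<close> rounds, then Player 2 would have a winning strategy \<open>\<tau>\<close>
  for those rounds, and surviving every finite number of rounds suffices by Koenig's lemma, since
  the game is finitely branching.  So fix \<open>\<tau>\<close> and count the plays against it that remain good for
  \<open>r\<close> rounds.  In the second of two adjacent blocks of length \<open>n\<close>, each move of Player 1 is compared
  with an earlier digit, so exactly one of its two values is a mismatch; by Chernoff's bound, only
  \<open>O(\<gamma>\<^sup>L)\<close> of the \<open>2\<^sup>L\<close> continuations through the \<open>L \<approx> n/(t+1)\<close> rounds of that block have too few
  mismatches, for some \<open>\<gamma> < 2\<close>.  Fix \<open>\<beta>\<close> strictly between \<open>\<gamma>\<close> and \<open>2\<close>.  If the number of good plays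
  has grown by a factor of at least \<open>\<beta>\<close> in all earlier rounds, then at most a proportion
  \<open>O(\<Sum>\<^sub>n (\<gamma>/\<beta>)\<^bsup>n/(t+1)\<^esup>)\<close> over \<open>n > N\<close> of the current good plays is lost, which is below \<open>2 - \<beta>\<close>
  for large \<open>N\<close>.  Hence the number keeps growing by the factor \<open>\<beta>\<close> and never reaches \<open>0\<close>.
\<close>

section \<open>Determinacy of the finite truncations\<close>

text \<open>A round is one digit \<open>b\<close> of Player 1 followed by \<open>t\<close> digits
  \<open>r\<close> of Player 2. The alternating quantifiers encode the truncated game, so a failure
  of \<open>survives\<close> directly supplies refuting replies for Player 2.\<close>

fun survives :: "nat \<Rightarrow> (bool list \<Rightarrow> bool) \<Rightarrow> nat \<Rightarrow> bool list \<Rightarrow> bool" where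
  "survives t P 0 h \<longleftrightarrow> P h"
| "survives t P (Suc m) h \<longleftrightarrow>
     P h \<and> (\<exists>b. \<forall>r. length r = t \<longrightarrow> survives t P m (h @ b # r))"

text \<open>\<open>\<tau>\<close> is a strategy of Player 2: it sees Player 1's new digit and
  returns the whole reply. Only Player 1's digit is left free.\<close>

definition extend :: "(bool list \<Rightarrow> bool list) \<Rightarrow> bool list set \<Rightarrow> bool list set" where
  "extend \<tau> A = (\<lambda>(h, b). h @ b # \<tau> (h @ [b])) ` (A \<times> UNIV)"

fun good_plays :: "(bool list \<Rightarrow> bool list) \<Rightarrow> (bool list \<Rightarrow> bool) \<Rightarrow> nat \<Rightarrow> bool list set" where
  "good_plays \<tau> P 0 = {[]}"
| "good_plays \<tau> P (Suc r) = {h \<in> extend \<tau> (good_plays \<tau> P r). P h}"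

lemma survives_imp: "survives t P m h \<Longrightarrow> P h"
  by (cases m) auto

lemma survives_mono: "survives t P m h \<Longrightarrow> m' \<le> m \<Longrightarrow> survives t P m' h"
proof (induction m arbitrary: m' h)
  case (Suc m)
  show ?case
  proof (cases m')
    case 0
    then show ?thesis using Suc.prems by simp
  next
    case (Suc l)
    then have "l \<le> m" using Suc.prems by simp
    then show ?thesis using Suc.prems Suc.IH Suc by (simp, blast)
  qed
qed simp

text \<open>Koenig step: if each of the two digits were refuted at some horizon, the larger horizon
  would refute survival at \<open>h\<close>.\<close>

lemma survives_forever_step:
  assumes "\<And>m. survives t P m h"
  shows "\<exists>b. \<forall>r. length r = t \<longrightarrow> (\<forall>m. survives t P m (h @ b # r))"
proof (rule ccontr)
  assume "\<not> ?thesis"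
  then have "\<forall>b. \<exists>r m. length r = t \<and> \<not> survives t P m (h @ b # r)"
    by blast
  then obtain R M where *: "\<And>b. length (R b) = t \<and> \<not> survives t P (M b) (h @ b # R b)"
    by metis
  have "survives t P (Suc (max (M True) (M False))) h"
    by (rule assms)
  then obtain b where "survives t P (max (M True) (M False)) (h @ b # R b)"
    using * by auto
  then have "survives t P (M b) (h @ b # R b)"
    by (rule survives_mono) (cases b; simp)
  with * show False by blast
qed

lemma history_round:
  "history \<alpha> (Suc m * (t + 1) + 1) =
     history \<alpha> (m * (t + 1) + 1) @ \<alpha> (m * (t + 1) + 1) # map \<alpha> [m * (t + 1) + 2..<m * (t + 1) + t + 2]"
proof -
  have "[1..<Suc m * (t + 1) + 1] =
      [1..<m * (t + 1) + 1] @ [m * (t + 1) + 1..<(m * (t + 1) + 1) + (t + 1)]"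
    using upt_add_eq_append[of 1 "m * (t + 1) + 1" "t + 1"] by (simp add: algebra_simps)
  also have "[m * (t + 1) + 1..<(m * (t + 1) + 1) + (t + 1)] =
      (m * (t + 1) + 1) # [m * (t + 1) + 2..<m * (t + 1) + t + 2]"
    by (subst upt_conv_Cons) (simp_all add: add.assoc)
  finally show ?thesis by (simp add: history_def)
qed

lemma player1_move_round: "player1_move t (m * (t + 1) + 1)"
  unfolding player1_move_def cong_def by (metis add.commute le_add2 mod_mult_self1)

lemma survives_imp_strategy:
  assumes "\<And>m. survives t P m []"
  shows "\<exists>\<sigma>. \<forall>\<alpha>. follows t \<sigma> \<alpha> \<longrightarrow> (\<forall>m. P (history \<alpha> (m * (t + 1) + 1)))"
proof -
  \<comment> \<open>Play to preserve survival for all horizons at once.\<close>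
  define \<sigma> where "\<sigma> h = (SOME b. \<forall>r. length r = t \<longrightarrow> (\<forall>m. survives t P m (h @ b # r)))" for h
  have \<sigma>: "survives t P m (h @ \<sigma> h # r)" if "\<And>m. survives t P m h" "length r = t" for h r m
    using someI_ex[OF survives_forever_step[OF that(1)]] that(2) unfolding \<sigma>_def by blast
  have "survives t P l (history \<alpha> (m * (t + 1) + 1))" if \<alpha>: "follows t \<sigma> \<alpha>" for \<alpha> m l
  proof (induction m arbitrary: l)
    case 0
    then show ?case using assms by (simp add: history_def)
  next
    case (Suc m)
    have "\<alpha> (m * (t + 1) + 1) = \<sigma> (history \<alpha> (m * (t + 1) + 1))"
      using \<alpha> player1_move_round unfolding follows_def by blast
    then show ?case unfolding history_round using \<sigma> Suc.IH by simp
  qed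
  then show ?thesis using survives_imp by blast
qed

text \<open>Determinacy: if Player 1 loses from \<open>[]\<close>, a single \<open>\<tau>\<close>
  keeps every good play lost until no round remains, and there being lost means that
  \<open>P\<close> fails.\<close>

lemma good_plays_imp_survives:
  assumes t: "t \<ge> 1" and P: "P []"
    and nonempty: "\<And>\<tau>. (\<And>l. length (\<tau> l) = t) \<Longrightarrow> good_plays \<tau> P M \<noteq> {}"
  shows "survives t P M []"
proof (rule ccontr)
  assume lost: "\<not> survives t P M []"
  \<comment> \<open>\<open>l\<close> ends with Player 1's digit of the current round. As
    \<open>t \<ge> 1\<close>, the quotient counts the completed rounds, and the difference is the
    number of rounds left after the reply.\<close>
  define Q where "Q l r \<longleftrightarrow> length r = t \<and>
    \<not> survives t P (M - Suc (length l div (t + 1))) (l @ r)" for l r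
  \<comment> \<open>The default gives the reply length \<open>t\<close> at histories without a
    refuting reply.\<close>
  define \<tau> where "\<tau> l = (if \<exists>r. Q l r then SOME r. Q l r else replicate t False)" for l
  have Q: "Q l (\<tau> l)" if "Q l r" for l r
    using that someI[of "Q l"] by (auto simp: \<tau>_def)
  have len: "length (\<tau> l) = t" for l
  proof (cases "\<exists>r. Q l r")
    case True
    then show ?thesis using Q unfolding Q_def by blast
  next
    case False
    then show ?thesis by (simp add: \<tau>_def)
  qed
  have "length h = r * (t + 1) \<and> P h \<and> \<not> survives t P (M - r) h"
    if "h \<in> good_plays \<tau> P r" "r \<le> M" for h r
    using that
  proof (induction r arbitrary: h)
    case 0
    then show ?case using lost P by simp
  next
    case (Suc r)
    then obtain h' b where h: "h = h' @ b # \<tau> (h' @ [b])" "h' \<in> good_plays \<tau> P r" "P h"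
      by (auto simp: extend_def)
    then have h': "length h' = r * (t + 1)" "P h'" "\<not> survives t P (M - r) h'"
      using Suc by auto
    have "M - r = Suc (M - Suc r)" using Suc.prems by simp
    then obtain s where s: "length s = t" "\<not> survives t P (M - Suc r) (h' @ b # s)"
      using h' by auto
    have "length (h' @ [b]) div (t + 1) = r"
      using h'(1) t by (intro div_nat_eqI) auto
    then have "Q (h' @ [b]) s" using s by (simp add: Q_def)
    then have "Q (h' @ [b]) (\<tau> (h' @ [b]))" by (rule Q)
    then show ?case
      using \<open>length (h' @ [b]) div (t + 1) = r\<close> h h' len by (simp add: Q_def)
  qed
  from this[of _ M] have "good_plays \<tau> P M = {}" by fastforce
  with nonempty len show False by blast
qed

section \<open>Counting plays\<close>

lemma length_extend:
  assumes "\<And>l. length (\<tau> l) = t" "\<And>h. h \<in> A \<Longrightarrow> length h = l" "h \<in> extend \<tau> A"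
  shows "length h = l + (t + 1)"
  using assms by (auto simp: extend_def)

lemma length_extend_funpow:
  assumes "\<And>l. length (\<tau> l) = t" "\<And>h. h \<in> A \<Longrightarrow> length h = l" "h \<in> (extend \<tau> ^^ L) A"
  shows "length h = l + L * (t + 1)"
  using assms(3)
proof (induction L arbitrary: h)
  case (Suc L)
  then show ?case
    using length_extend[of \<tau> t "(extend \<tau> ^^ L) A" "l + L * (t + 1)" h, OF assms(1)] by simp
qed (simp add: assms)

lemma extend_mono: "A \<subseteq> B \<Longrightarrow> extend \<tau> A \<subseteq> extend \<tau> B"
  by (auto simp: extend_def)

lemma finite_extend: "finite A \<Longrightarrow> finite (extend \<tau> A)"
  by (simp add: extend_def)

lemma finite_extend_funpow: "finite A \<Longrightarrow> finite ((extend \<tau> ^^ L) A)"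
  by (induction L) (auto simp: finite_extend)

lemma inj_on_extend:
  assumes "\<And>h. h \<in> A \<Longrightarrow> length h = l"
  shows "inj_on (\<lambda>(h, b). h @ b # \<tau> (h @ [b])) (A \<times> UNIV)"
  by (rule inj_onI) (auto simp: assms)

lemma sum_extend:
  assumes "\<And>h. h \<in> A \<Longrightarrow> length h = l"
  shows "sum f (extend \<tau> A) = (\<Sum>h\<in>A. f (h @ True # \<tau> (h @ [True])) + f (h @ False # \<tau> (h @ [False])))"
  unfolding extend_def
  by (subst sum.reindex[OF inj_on_extend[OF assms]])
    (simp_all add: sum.cartesian_product' UNIV_bool add.commute)

lemma card_extend:
  assumes "\<And>h. h \<in> A \<Longrightarrow> length h = l"
  shows "card (extend \<tau> A) = 2 * card A"
  using sum_extend[OF assms, where f = "\<lambda>_. 1::nat" and \<tau> = \<tau>] by simp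

text \<open>List positions start at 0, so with \<open>d = t + 1\<close> Player 1's digit of round
  \<open>i\<close> sits at \<open>i * d\<close>.\<close>

definition mismatches :: "nat \<Rightarrow> nat \<Rightarrow> nat \<Rightarrow> nat \<Rightarrow> bool list \<Rightarrow> nat" where
  "mismatches d n p m h = card {i \<in> {p..<m}. h ! (i * d) \<noteq> h ! (i * d - n)}"

text \<open>Since \<open>n \<ge> 1\<close>, the digit compared with is fixed in \<open>h\<close>
  before \<open>b\<close> is chosen.\<close>

lemma mismatches_append:
  assumes len: "length h = m * d" and "n \<ge> 1" "n \<le> p * d" "p \<le> m"
  shows "mismatches d n p (Suc m) (h @ b # u) =
    mismatches d n p m h + (if b = h ! (m * d - n) then 0 else 1)"
proof -
  have "m * d \<ge> n" using assms by (meson le_trans mult_le_mono1)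
  then have eq: "{i \<in> {p..<Suc m}. (h @ b # u) ! (i * d) \<noteq> (h @ b # u) ! (i * d - n)} =
      {i \<in> {p..<m}. h ! (i * d) \<noteq> h ! (i * d - n)} \<union> (if b = h ! (m * d - n) then {} else {m})"
    (is "?A = ?B \<union> ?C")
  proof -
    have "i \<in> ?A \<longleftrightarrow> i \<in> ?B \<union> ?C" for i
    proof (cases "i < m")
      case True
      moreover have "d > 0" using assms by (cases d) auto
      ultimately have "i * d < m * d" "i * d - n < m * d" by (auto intro: less_imp_diff_less)
      then show ?thesis using True by (auto simp: nth_append len)
    next
      case False
      then show ?thesis
        using len \<open>m * d \<ge> n\<close> assms(2,4) by (cases "i = m") (auto simp: nth_append)
    qed
    then show ?thesis by blast
  qed
  show ?thesis
    unfolding mismatches_def eq by (subst card_Un_disjoint) auto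
qed

text \<open>Generating function: in each round one digit of Player 1 contributes the factor 1 and
  the other \<open>x\<close>, whatever \<open>\<tau>\<close> replies. So mismatches are exactly
  binomially distributed.\<close>

lemma sum_power_mismatches:
  fixes x :: real
  assumes \<tau>: "\<And>l. length (\<tau> l) = t" and A: "\<And>h. h \<in> A \<Longrightarrow> length h = p * (t + 1)"
    and n: "n \<ge> 1" "n \<le> p * (t + 1)"
  shows "(\<Sum>h \<in> (extend \<tau> ^^ L) A. x ^ mismatches (t + 1) n p (p + L) h) = real (card A) * (1 + x) ^ L"
proof (induction L)
  case 0
  then show ?case by (simp add: mismatches_def)
next
  case (Suc L)
  have len: "length h = (p + L) * (t + 1)" if "h \<in> (extend \<tau> ^^ L) A" for h
    using length_extend_funpow[OF \<tau> A that] by (simp add: algebra_simps)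
  have "(\<Sum>h \<in> (extend \<tau> ^^ Suc L) A. x ^ mismatches (t + 1) n p (p + Suc L) h) =
      (\<Sum>h \<in> (extend \<tau> ^^ L) A. x ^ mismatches (t + 1) n p (p + L) h * (1 + x))"
    unfolding funpow.simps o_def
  proof (subst sum_extend[OF len], assumption, rule sum.cong)
    fix h assume "h \<in> (extend \<tau> ^^ L) A"
    note * = mismatches_append[OF len[OF this] n, of _ "\<tau> _"]
    show "x ^ mismatches (t + 1) n p (p + Suc L) (h @ True # \<tau> (h @ [True])) +
        x ^ mismatches (t + 1) n p (p + Suc L) (h @ False # \<tau> (h @ [False])) =
        x ^ mismatches (t + 1) n p (p + L) h * (1 + x)"
      unfolding add_Suc_right using * by (simp add: algebra_simps)
  qed simp
  then show ?case using Suc by (simp add: sum_distrib_right[symmetric])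
qed

text \<open>Markov's inequality for the weight \<open>x ^ mismatches\<close>, which is at least
  \<open>x powr s\<close> on the counted set because \<open>x \<le> 1\<close>.\<close>

lemma card_few_mismatches_le:
  fixes x s :: real
  assumes \<tau>: "\<And>l. length (\<tau> l) = t" and A: "\<And>h. h \<in> A \<Longrightarrow> length h = p * (t + 1)" "finite A"
    and n: "n \<ge> 1" "n \<le> p * (t + 1)" and x: "0 < x" "x \<le> 1"
  shows "real (card {h \<in> (extend \<tau> ^^ L) A. real (mismatches (t + 1) n p (p + L) h) < s})
    \<le> x powr (- s) * (1 + x) ^ L * real (card A)"
proof -
  let ?B = "{h \<in> (extend \<tau> ^^ L) A. real (mismatches (t + 1) n p (p + L) h) < s}"
  have fin: "finite ((extend \<tau> ^^ L) A)" using A by (rule_tac finite_extend_funpow)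
  have "real (card ?B) * x powr s = (\<Sum>h\<in>?B. x powr s)" by simp
  also have "\<dots> \<le> (\<Sum>h\<in>?B. x ^ mismatches (t + 1) n p (p + L) h)"
  proof (rule sum_mono)
    fix h assume "h \<in> ?B"
    then have "x powr s \<le> x powr real (mismatches (t + 1) n p (p + L) h)"
      using x by (intro powr_mono') auto
    then show "x powr s \<le> x ^ mismatches (t + 1) n p (p + L) h"
      using x by (simp add: powr_realpow)
  qed
  also have "\<dots> \<le> (\<Sum>h\<in>(extend \<tau> ^^ L) A. x ^ mismatches (t + 1) n p (p + L) h)"
    using fin x by (intro sum_mono2) auto
  also have "\<dots> = real (card A) * (1 + x) ^ L"
    by (rule sum_power_mismatches[OF \<tau> A(1) n])
  finally show ?thesis
    using x by (simp add: powr_minus field_simps)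
qed

section \<open>Growth of the number of good plays\<close>

definition separated :: "nat \<Rightarrow> real \<Rightarrow> bool list \<Rightarrow> bool" where
  "separated N \<delta> h \<longleftrightarrow> (\<forall>k n. N \<le> n \<and> k + 2 * n \<le> length h \<longrightarrow>
     \<delta> * real n \<le> real (card {j \<in> {..<n}. h ! (k + j) \<noteq> h ! (k + n + j)}))"

text \<open>Consequently only pairs of blocks ending in the newest round can newly fail.\<close>

lemma separated_appendD:
  assumes "separated N \<delta> h" "k + 2 * n \<le> length h" "N \<le> n"
  shows "\<delta> * real n \<le> real (card {j \<in> {..<n}. (h @ u) ! (k + j) \<noteq> (h @ u) ! (k + n + j)})"
proof -
  have "{j \<in> {..<n}. (h @ u) ! (k + j) \<noteq> (h @ u) ! (k + n + j)} =
      {j \<in> {..<n}. h ! (k + j) \<noteq> h ! (k + n + j)}"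
    using assms(2) by (auto simp: nth_append)
  then show ?thesis using assms by (simp add: separated_def)
qed

text \<open>Player 1's moves of rounds \<open>p\<close> to \<open>r\<close> lie in the second block;
  subtracting \<open>k + n\<close> gives their offsets there.\<close>

lemma mismatches_le_card:
  assumes "k + n \<le> p * d" "r * d < k + 2 * n" "d \<ge> 1"
  shows "mismatches d n p (Suc r) h \<le> card {j \<in> {..<n}. h ! (k + j) \<noteq> h ! (k + n + j)}"
  unfolding mismatches_def
proof (rule card_inj_on_le[where f = "\<lambda>i. i * d - (k + n)"])
  have ge: "k + n \<le> i * d" if "p \<le> i" for i
    using assms(1) that by (meson le_trans mult_le_mono1)
  have lt: "i * d < k + 2 * n" if "i < Suc r" for i
    using assms(2) that by (meson less_Suc_eq_le mult_le_mono1 order_le_less_trans)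
  show "inj_on (\<lambda>i. i * d - (k + n)) {i \<in> {p..<Suc r}. h ! (i * d) \<noteq> h ! (i * d - n)}"
  proof (rule inj_onI)
    fix i j
    assume "i \<in> {i \<in> {p..<Suc r}. h ! (i * d) \<noteq> h ! (i * d - n)}"
      "j \<in> {i \<in> {p..<Suc r}. h ! (i * d) \<noteq> h ! (i * d - n)}"
      and eq: "i * d - (k + n) = j * d - (k + n)"
    then have "k + n \<le> i * d" "k + n \<le> j * d" using ge by auto
    with eq have "i * d = j * d" by linarith
    with assms(3) show "i = j" by simp
  qed
  show "(\<lambda>i. i * d - (k + n)) ` {i \<in> {p..<Suc r}. h ! (i * d) \<noteq> h ! (i * d - n)}
      \<subseteq> {j \<in> {..<n}. h ! (k + j) \<noteq> h ! (k + n + j)}"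
  proof clarsimp
    fix i assume i: "p \<le> i" "i < Suc r" "h ! (i * d) = (\<not> h ! (i * d - n))"
    have *: "k + n \<le> i * d" "i * d < k + 2 * n" using ge lt i by auto
    then have "k + (i * d - (k + n)) = i * d - n" "k + n + (i * d - (k + n)) = i * d"
      "i * d - (k + n) < n"
      by linarith+
    then show "i * d - (k + n) < n \<and> h ! (k + (i * d - (k + n))) = (\<not> h ! (k + n + (i * d - (k + n))))"
      using i by simp
  qed
qed simp

lemma finite_good_plays: "finite (good_plays \<tau> P r)"
  by (induction r) (auto simp: finite_extend)

lemma length_good_plays:
  assumes "\<And>l. length (\<tau> l) = t" "h \<in> good_plays \<tau> P r"
  shows "length h = r * (t + 1)"
  using assms(2)
proof (induction r arbitrary: h)
  case (Suc r)
  then show ?case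
    using length_extend[of \<tau> t "good_plays \<tau> P r" "r * (t + 1)" h, OF assms(1)] by simp
qed simp

lemma good_plays_subset: "good_plays \<tau> P (p + L) \<subseteq> (extend \<tau> ^^ L) (good_plays \<tau> P p)"
proof (induction L)
  case (Suc L)
  have "good_plays \<tau> P (p + Suc L) \<subseteq> extend \<tau> (good_plays \<tau> P (p + L))" by auto
  also have "\<dots> \<subseteq> extend \<tau> ((extend \<tau> ^^ L) (good_plays \<tau> P p))"
    by (rule extend_mono[OF Suc])
  finally show ?case by simp
qed simp

text \<open>
  Player 1's moves in the second block are those of the rounds \<open>p, \<dots>, r\<close> (rounds are
  counted from \<open>0\<close>), so a play that fails for the pair \<open>(k, n)\<close> is one of the few continuations with
  too few mismatches of a good play of \<open>p\<close> rounds.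
\<close>

lemma card_bad_pair_le:
  fixes x c \<beta> :: real
  assumes \<tau>: "\<And>l. length (\<tau> l) = t" and x: "0 < x" "x \<le> 1" and c: "c \<ge> 0"
    and \<gamma>: "\<gamma> = (1 + x) * x powr (- c)" and \<beta>: "0 < \<beta>" "\<gamma> \<le> \<beta>"
    and n: "t + 1 \<le> n" and k: "r * (t + 1) < k + 2 * n" "k + 2 * n \<le> Suc r * (t + 1)"
    and grow: "\<And>p. p \<le> r \<Longrightarrow>
      \<beta> ^ (r - p) * real (card (good_plays \<tau> P p)) \<le> real (card (good_plays \<tau> P r))"
  shows "real (card {h \<in> extend \<tau> (good_plays \<tau> P r).
      real (card {j \<in> {..<n}. h ! (k + j) \<noteq> h ! (k + n + j)}) < c / real (t + 1) * real n})
    \<le> x powr (- c) * \<beta> * (\<gamma> / \<beta>) ^ (n div (t + 1)) * real (card (good_plays \<tau> P r))"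
    (is "real (card ?B) \<le> _")
proof -
  define d where "d = t + 1"
  \<comment> \<open>The ceiling of \<open>(k + n) / d\<close>: the first round that starts no
    earlier than the second block.\<close>
  define p where "p = (k + n + t) div d"
  define L where "L = Suc r - p"
  let ?G = "good_plays \<tau> P"
  have d: "d \<ge> 1" by (simp add: d_def)
  have p1: "k + n \<le> p * d"
  proof -
    have "k + n + t < Suc p * d"
      unfolding p_def using d by (metis dividend_less_div_times mult_Suc add.commute
        less_le_trans zero_less_one)
    then show ?thesis by (simp add: d_def)
  qed
  have p2: "p + n div d \<le> Suc r"
  proof -
    have "p * d \<le> k + n + t" unfolding p_def by simp
    moreover have "n div d * d \<le> n" by simp
    ultimately have "(p + n div d) * d \<le> k + 2 * n + t"
      unfolding add_mult_distrib by linarith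
    also have "\<dots> < Suc (Suc r) * d" using k(2) by (simp add: d_def)
    finally show ?thesis by (metis less_Suc_eq_le mult_less_cancel2)
  qed
  have "n div d \<ge> 1" using n d by (simp add: d_def Suc_le_eq div_greater_zero_iff)
  then have pr: "p \<le> r" "L = Suc (r - p)" "n div d \<le> L" "p + L = Suc r"
    using p2 by (auto simp: L_def)
  \<comment> \<open>The second block may hold slightly fewer than \<open>n / d\<close> moves of
    Player 1; the slack of 1 costs the factor \<open>x powr (- c)\<close> below.\<close>
  have nd: "real n / real d \<le> real L + 1"
  proof -
    have "real n / real d < real (n div d) + 1"
      using floor_divide_of_nat_eq[of n d, where ?'a = real] by linarith
    then show ?thesis using pr(3) by linarith
  qed
  have "extend \<tau> (?G r) \<subseteq> (extend \<tau> ^^ L) (?G p)"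
    using extend_mono[OF good_plays_subset[of \<tau> P p "r - p"]] pr by simp
  moreover have "mismatches d n p (p + L) h \<le> card {j \<in> {..<n}. h ! (k + j) \<noteq> h ! (k + n + j)}" for h
    using mismatches_le_card[of k n p d r h] p1 k d pr(4) by (simp add: d_def)
  ultimately have "?B \<subseteq> {h \<in> (extend \<tau> ^^ L) (?G p).
      real (mismatches (t + 1) n p (p + L) h) < c / real (t + 1) * real n}"
    unfolding d_def by (smt (verit) Collect_mono_iff of_nat_mono subsetD)
  then have "real (card ?B) \<le> real (card {h \<in> (extend \<tau> ^^ L) (?G p).
      real (mismatches (t + 1) n p (p + L) h) < c / real (t + 1) * real n})"
    using finite_good_plays finite_extend_funpow
    by (intro of_nat_mono card_mono) auto
  also have "\<dots> \<le> x powr (- (c / real (t + 1) * real n)) * (1 + x) ^ L * real (card (?G p))"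
    using p1 n x
    by (intro card_few_mismatches_le \<tau> length_good_plays[OF \<tau>] finite_good_plays)
      (auto simp: d_def)
  also have "\<dots> \<le> (x powr (- c) * \<gamma> ^ L) * real (card (?G p))"
  proof (rule mult_right_mono)
    have "c * (real n / real d) \<le> c * (real L + 1)"
      using nd c by (rule mult_left_mono)
    then have "x powr (- (c / real (t + 1) * real n)) \<le> x powr (- (c * (real L + 1)))"
      using x by (intro powr_mono') (auto simp: d_def)
    also have "\<dots> = x powr (- c) * (x powr (- c)) powr real L"
      by (simp add: powr_powr powr_add[symmetric] algebra_simps)
    also have "\<dots> = x powr (- c) * (x powr (- c)) ^ L"
      using x by (simp add: powr_realpow)
    finally have "x powr (- (c / real (t + 1) * real n)) * (1 + x) ^ L \<le>
        x powr (- c) * (x powr (- c)) ^ L * (1 + x) ^ L"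
      using x by (intro mult_right_mono) auto
    then show "x powr (- (c / real (t + 1) * real n)) * (1 + x) ^ L \<le> x powr (- c) * \<gamma> ^ L"
      by (simp add: \<gamma> power_mult_distrib mult_ac)
  qed simp
  \<comment> \<open>Prepares the use of \<open>grow\<close>, which trades good plays of
    \<open>p\<close> rounds for those of \<open>r\<close> rounds. As \<open>L = Suc (r - p)\<close>,
    one factor \<open>\<beta>\<close> is left over.\<close>
  also have "\<dots> = x powr (- c) * \<beta> * (\<gamma> / \<beta>) ^ L * (\<beta> ^ (r - p) * real (card (?G p)))"
    using \<beta> pr(2) by (simp add: field_simps)
  also have "\<dots> \<le> x powr (- c) * \<beta> * (\<gamma> / \<beta>) ^ L * real (card (?G r))"
    using grow[OF pr(1)] x \<beta> by (intro mult_left_mono) (auto simp: \<gamma>)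
  also have "\<dots> \<le> x powr (- c) * \<beta> * (\<gamma> / \<beta>) ^ (n div d) * real (card (?G r))"
    using pr(3) x \<beta> by (intro mult_right_mono mult_left_mono power_decreasing) (auto simp: \<gamma>)
  finally show ?thesis by (simp add: d_def)
qed

text \<open>Free extension doubles the count, and a union bound over the pairs ending in the new
  round loses at most \<open>2 - \<beta>\<close> times the old count. The induction is strong
  because each bad pair is traced back to an earlier round.\<close>

lemma good_plays_grow:
  fixes x c \<beta> :: real
  assumes \<tau>: "\<And>l. length (\<tau> l) = t" and x: "0 < x" "x \<le> 1" and c: "c \<ge> 0"
    and \<gamma>: "\<gamma> = (1 + x) * x powr (- c)" and \<beta>: "0 < \<beta>" "\<gamma> \<le> \<beta>"
    and N: "t + 1 \<le> N"
    and small: "\<And>M. real (t + 1) * (x powr (- c) * \<beta>) * (\<Sum>n\<in>{N..<M}. (\<gamma> / \<beta>) ^ (n div (t + 1))) \<le> 2 - \<beta>"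
  shows "\<beta> * real (card (good_plays \<tau> (separated N (c / real (t + 1))) r))
    \<le> real (card (good_plays \<tau> (separated N (c / real (t + 1))) (Suc r)))"
proof (induction r rule: less_induct)
  case (less r)
  let ?P = "separated N (c / real (t + 1))"
  let ?G = "good_plays \<tau> ?P"
  let ?d = "t + 1"
  let ?g = "real (card (?G r))"
  have grow': "p + i \<le> r \<Longrightarrow> \<beta> ^ i * real (card (?G p)) \<le> real (card (?G (p + i)))" for p i
  proof (induction i)
    case (Suc i)
    then have "\<beta> * (\<beta> ^ i * real (card (?G p))) \<le> \<beta> * real (card (?G (p + i)))"
      using \<beta> by (intro mult_left_mono) auto
    also have "\<dots> \<le> real (card (?G (Suc (p + i))))"
      using less.IH[of "p + i"] Suc.prems by simp
    finally show ?case by (simp add: mult_ac)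
  qed simp
  have grow: "\<beta> ^ (r - p) * real (card (?G p)) \<le> ?g" if "p \<le> r" for p
    using grow'[of p "r - p"] that by simp
  define Bad where "Bad n k = {h \<in> extend \<tau> (?G r).
      real (card {j \<in> {..<n}. h ! (k + j) \<noteq> h ! (k + n + j)}) < c / real ?d * real n}" for n k
  \<comment> \<open>Pairs must fit into the play, whence \<open>n < M\<close>. For each
    \<open>n\<close>, at most \<open>t + 1\<close> starts \<open>k\<close> make the pair end in the
    new round; this is the factor \<open>real (t + 1)\<close> in \<open>small\<close>.\<close>
  define M where "M = Suc (Suc r * ?d)"
  define K where "K n = {k. r * ?d < k + 2 * n \<and> k + 2 * n \<le> Suc r * ?d}" for n
  have finK: "finite (K n)" for n
    by (rule finite_subset[of _ "{..Suc r * ?d}"]) (auto simp: K_def)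
  have cardK: "card (K n) \<le> ?d" for n
  proof -
    have "card (K n) \<le> card {r * ?d<..Suc r * ?d}"
      by (rule card_inj_on_le[where f = "\<lambda>k. k + 2 * n"]) (auto simp: K_def)
    then show ?thesis by simp
  qed
  have fin: "finite (extend \<tau> (?G r))" by (intro finite_extend finite_good_plays)
  have len: "length h = r * ?d" if "h \<in> ?G r" for h
    using length_good_plays[OF \<tau> that] .
  have "extend \<tau> (?G r) - ?G (Suc r) \<subseteq> (\<Union>n\<in>{N..<M}. \<Union>k\<in>K n. Bad n k)"
  proof
    fix h assume h: "h \<in> extend \<tau> (?G r) - ?G (Suc r)"
    then have "\<not> ?P h" by simp
    then obtain k n where kn: "N \<le> n" "k + 2 * n \<le> length h"
      "real (card {j \<in> {..<n}. h ! (k + j) \<noteq> h ! (k + n + j)}) < c / real ?d * real n"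
      by (auto simp: separated_def not_le)
    obtain g u where g: "g \<in> ?G r" "h = g @ u" using h by (auto simp: extend_def)
    have sep: "?P g"
    \<comment> \<open>Round 0 is not filtered by \<open>?P\<close>, but the empty list admits only
      \<open>n = 0\<close>.\<close>
    proof (cases r)
      case 0
      then show ?thesis using g by (simp add: separated_def)
    next
      case (Suc i)
      then show ?thesis using g by simp
    qed
    have "r * ?d < k + 2 * n"
    proof (rule ccontr)
      assume "\<not> ?thesis"
      then have "k + 2 * n \<le> length g" using len[OF g(1)] by simp
      from separated_appendD[OF sep this kn(1), of u] show False
        using kn(3) g(2) by simp
    qed
    moreover have lenh: "length h = Suc r * ?d"
      using length_extend[of \<tau> t "?G r", OF \<tau> len] h by simp
    ultimately have "k \<in> K n" "n < M" using kn(2) by (auto simp: K_def M_def)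
    moreover have "h \<in> Bad n k" using kn(3) h by (simp add: Bad_def)
    ultimately show "h \<in> (\<Union>n\<in>{N..<M}. \<Union>k\<in>K n. Bad n k)" using kn(1) by auto
  qed
  then have "card (extend \<tau> (?G r) - ?G (Suc r)) \<le> card (\<Union>n\<in>{N..<M}. \<Union>k\<in>K n. Bad n k)"
    by (rule card_mono[rotated])
      (use finK in \<open>auto simp: Bad_def intro!: finite_subset[OF _ fin]\<close>)
  also have "\<dots> \<le> (\<Sum>n\<in>{N..<M}. card (\<Union>k\<in>K n. Bad n k))"
    by (rule card_UN_le) simp
  also have "\<dots> \<le> (\<Sum>n\<in>{N..<M}. \<Sum>k\<in>K n. card (Bad n k))"
    by (intro sum_mono card_UN_le finK)
  finally have "real (card (extend \<tau> (?G r) - ?G (Suc r))) \<le>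
      (\<Sum>n\<in>{N..<M}. \<Sum>k\<in>K n. real (card (Bad n k)))"
    unfolding of_nat_sum[symmetric] by (simp only: of_nat_le_iff)
  also have "\<dots> \<le> (\<Sum>n\<in>{N..<M}. \<Sum>k\<in>K n. x powr (- c) * \<beta> * (\<gamma> / \<beta>) ^ (n div ?d) * ?g)"
    unfolding Bad_def
    using N by (intro sum_mono card_bad_pair_le[OF \<tau> x c \<gamma> \<beta> _ _ _ grow]) (auto simp: K_def)
  also have "\<dots> \<le> (\<Sum>n\<in>{N..<M}. real ?d * (x powr (- c) * \<beta> * (\<gamma> / \<beta>) ^ (n div ?d) * ?g))"
  proof (rule sum_mono)
    fix n
    have "0 \<le> x powr (- c) * \<beta> * (\<gamma> / \<beta>) ^ (n div ?d) * ?g" using x \<beta> by (simp add: \<gamma>)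
    then show "(\<Sum>k\<in>K n. x powr (- c) * \<beta> * (\<gamma> / \<beta>) ^ (n div ?d) * ?g)
        \<le> real ?d * (x powr (- c) * \<beta> * (\<gamma> / \<beta>) ^ (n div ?d) * ?g)"
      unfolding sum_constant using cardK[of n] by (intro mult_right_mono) (simp_all only: of_nat_le_iff)
  qed
  also have "\<dots> = real ?d * (x powr (- c) * \<beta>) * (\<Sum>n\<in>{N..<M}. (\<gamma> / \<beta>) ^ (n div ?d)) * ?g"
    unfolding sum_distrib_left sum_distrib_right by (intro sum.cong) (simp_all only: mult_ac)
  also have "\<dots> \<le> (2 - \<beta>) * ?g"
    using small by (rule mult_right_mono) simp
  finally have bad: "real (card (extend \<tau> (?G r) - ?G (Suc r))) \<le> (2 - \<beta>) * ?g" .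
  have "card (extend \<tau> (?G r) - ?G (Suc r)) = card (extend \<tau> (?G r)) - card (?G (Suc r))"
    by (rule card_Diff_subset) (auto intro: finite_subset[OF _ fin])
  moreover have "card (?G (Suc r)) \<le> card (extend \<tau> (?G r))"
    by (rule card_mono[OF fin]) auto
  moreover have "card (extend \<tau> (?G r)) = 2 * card (?G r)"
    by (rule card_extend[OF len])
  ultimately have "real (card (extend \<tau> (?G r) - ?G (Suc r))) = 2 * ?g - real (card (?G (Suc r)))"
    by simp
  then show ?case using bad by (simp add: algebra_simps)
qed

section \<open>Choice of the constants\<close>

text \<open>
  At \<open>x = 1\<close> the function \<open>ln (1 + x) - c ln x\<close> has value \<open>ln 2\<close> and derivative
  \<open>1/2 - c > 0\<close>.
\<close>

lemma exists_chernoff_base: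
  fixes c :: real
  assumes "c < 1 / 2"
  shows "\<exists>x. 0 < x \<and> x < 1 \<and> (1 + x) * x powr (- c) < 2"
proof -
  define f where "f x = ln (1 + x) - c * ln x" for x :: real
  have "(f has_real_derivative (1 / 2 - c)) (at 1)"
    unfolding f_def by (auto intro!: derivative_eq_intros)
  then obtain e where e: "e > 0" "\<And>h. 0 < h \<Longrightarrow> h < e \<Longrightarrow> f (1 - h) < f 1"
    using DERIV_pos_inc_left[of f "1 / 2 - c" 1] assms by auto
  define x where "x = 1 - min (e / 2) (1 / 2)"
  have x: "0 < x" "x < 1" using e(1) by (auto simp: x_def)
  have "f x < ln 2" using e(2)[of "min (e / 2) (1 / 2)"] e(1) by (auto simp: f_def x_def)
  then have "exp (f x) < 2" by (metis exp_less_cancel_iff exp_ln zero_less_numeral)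
  moreover have "exp (f x) = (1 + x) * x powr (- c)"
    using x by (simp add: f_def powr_def exp_diff exp_minus field_simps)
  ultimately show ?thesis using x by auto
qed

text \<open>Rounding down costs at most a factor \<open>1 / q\<close> against the geometric series
  of ratio \<open>q powr (1 / d)\<close>.\<close>

lemma summable_power_div:
  fixes q :: real
  assumes "0 < q" "q < 1" "d \<ge> 1"
  shows "summable (\<lambda>n. q ^ (n div d))"
proof (rule summable_comparison_test')
  have "q powr (1 / real d) < 1"
    using assms powr_less_mono2[of "1 / real d" q 1] by simp
  then show "summable (\<lambda>n. (1 / q) * (q powr (1 / real d)) ^ n)"
    by (intro summable_mult summable_geometric) simp
  fix n :: nat
  have "real n / real d < real (n div d) + 1"
    using floor_divide_of_nat_eq[of n d, where ?'a = real] by linarith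
  then have "q powr real (n div d) \<le> q powr (real n / real d - 1)"
    using assms by (intro powr_mono') auto
  also have "\<dots> = (1 / q) * (q powr (1 / real d)) ^ n"
    using assms by (simp add: powr_diff powr_powr flip: powr_realpow)
  finally show "norm (q ^ (n div d)) \<le> (1 / q) * (q powr (1 / real d)) ^ n"
    using assms by (simp add: powr_realpow)
qed

text \<open>The order of quantifiers matters: \<open>N\<close> is fixed before determinacy produces
  an adversarial \<open>\<tau>\<close>.\<close>

lemma good_plays_nonempty:
  fixes c :: real
  assumes c: "0 \<le> c" "c < 1 / 2"
  shows "\<exists>N. \<forall>\<tau> r. (\<forall>l. length (\<tau> l) = t) \<longrightarrow>
    good_plays \<tau> (separated N (c / real (t + 1))) r \<noteq> {}"
proof -
  obtain x where x: "0 < x" "x < 1" "(1 + x) * x powr (- c) < 2"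
    using exists_chernoff_base[OF c(2)] by blast
  define \<gamma> where "\<gamma> = (1 + x) * x powr (- c)"
  \<comment> \<open>The midpoint of \<open>\<gamma>\<close> and 2: the ratio
    \<open>\<gamma> / \<beta>\<close> is below 1, and \<open>2 - \<beta>\<close> leaves room for the
    tail of the series.\<close>
  define \<beta> where "\<beta> = (\<gamma> + 2) / 2"
  have \<gamma>0: "\<gamma> > 0" using x by (simp add: \<gamma>_def)
  moreover have "\<gamma> < 2" using x(3) by (simp add: \<gamma>_def)
  ultimately have \<beta>: "0 < \<beta>" "\<gamma> < \<beta>" "\<beta> < 2" by (simp_all add: \<beta>_def)
  define C where "C = real (t + 1) * (x powr (- c) * \<beta>)"
  have C: "C > 0" using x \<beta> by (simp add: C_def)
  have "summable (\<lambda>n. (\<gamma> / \<beta>) ^ (n div (t + 1)))"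
    using \<beta> \<gamma>0 by (intro summable_power_div) auto
  moreover have "(2 - \<beta>) / C > 0" using \<beta> C by simp
  ultimately obtain N0 where
    N0: "\<And>m M. m \<ge> N0 \<Longrightarrow> norm (\<Sum>n\<in>{m..<M}. (\<gamma> / \<beta>) ^ (n div (t + 1))) < (2 - \<beta>) / C"
    unfolding summable_Cauchy by meson
  \<comment> \<open>The bound \<open>t + 1\<close> ensures that every second block contains a move
    of Player 1.\<close>
  define N where "N = max N0 (t + 1)"
  have small: "C * (\<Sum>n\<in>{N..<M}. (\<gamma> / \<beta>) ^ (n div (t + 1))) \<le> 2 - \<beta>" for M
  proof -
    have "(\<Sum>n\<in>{N..<M}. (\<gamma> / \<beta>) ^ (n div (t + 1))) \<le> (2 - \<beta>) / C"
      using N0[of N M] by (simp add: N_def)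
    then show ?thesis using C by (simp add: field_simps)
  qed
  have "good_plays \<tau> (separated N (c / real (t + 1))) r \<noteq> {}" if \<tau>: "\<And>l. length (\<tau> l) = t" for \<tau> r
  proof -
    have "real (card (good_plays \<tau> (separated N (c / real (t + 1))) r)) > 0"
    proof (induction r)
      case (Suc r)
      have "\<beta> * real (card (good_plays \<tau> (separated N (c / real (t + 1))) r)) \<le>
          real (card (good_plays \<tau> (separated N (c / real (t + 1))) (Suc r)))"
        using x c \<beta> small
        by (intro good_plays_grow[OF \<tau> _ _ _ \<gamma>_def]) (auto simp: N_def C_def)
      then show ?case using Suc \<beta>(1) by (smt (verit) mult_pos_pos)
    qed simp
    then show ?thesis by auto
  qed
  then show ?thesis by blast
qed

section \<open>From finite plays to infinite sequences\<close>

lemma card_shift: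
  "card {j \<in> {..<n}. Q (Suc j)} = card {j \<in> {1..n}. Q j}"
proof -
  have "{j \<in> {1..n}. Q j} = Suc ` {j \<in> {..<n}. Q (Suc j)}"
  proof
    show "{j \<in> {1..n}. Q j} \<subseteq> Suc ` {j \<in> {..<n}. Q (Suc j)}"
    proof
      fix j assume "j \<in> {j \<in> {1..n}. Q j}"
      then show "j \<in> Suc ` {j \<in> {..<n}. Q (Suc j)}"
        by (intro image_eqI[of _ _ "j - 1"]) auto
    qed
  qed auto
  then show ?thesis by (simp add: card_image)
qed

theorem theorem1p5:
  fixes t :: nat
  assumes "t \<ge> 1"
  shows "\<forall>\<epsilon>::real. \<epsilon> > 0 \<longrightarrow>
    (\<exists>N::int. \<exists>\<sigma>. ensures t \<sigma> (\<lambda>\<alpha>.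
      \<forall>k n :: nat. int n > N \<longrightarrow>
        real (card {j \<in> {1..n}. \<alpha> (k + j) \<noteq> \<alpha> (k + n + j)})
          \<ge> (1 / (2 * real t + 2) - \<epsilon>) * real n))"
proof (intro allI impI)
  fix \<epsilon> :: real assume \<epsilon>: "\<epsilon> > 0"
  \<comment> \<open>\<open>c\<close> is the mismatch rate demanded per move of Player 1:
    \<open>t + 1\<close> times the target density, raised to 0 when \<open>\<epsilon>\<close> is
    large.\<close>
  define c where "c = max 0 (1 / 2 - \<epsilon> * real (t + 1))"
  have c: "0 \<le> c" "c < 1 / 2" using mult_pos_pos[OF \<epsilon>, of "real (t + 1)"]
    by (auto simp: c_def max_def)
  have c_ge: "1 / (2 * real t + 2) - \<epsilon> \<le> c / real (t + 1)"
  proof -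
    have "1 / (2 * real t + 2) - \<epsilon> = (1 / 2 - \<epsilon> * real (t + 1)) / real (t + 1)"
      by (simp add: field_simps)
    also have "\<dots> \<le> c / real (t + 1)"
      by (intro divide_right_mono) (simp_all add: c_def)
    finally show ?thesis .
  qed
  obtain N where N: "\<And>\<tau> r. (\<And>l. length (\<tau> l) = t) \<Longrightarrow>
      good_plays \<tau> (separated N (c / real (t + 1))) r \<noteq> {}"
    using good_plays_nonempty[OF c, of t] by blast
  let ?P = "separated N (c / real (t + 1))"
  have "survives t ?P m []" for m
    by (rule good_plays_imp_survives[OF assms _ N]) (auto simp: separated_def)
  then obtain \<sigma> where \<sigma>: "\<And>\<alpha> m. follows t \<sigma> \<alpha> \<Longrightarrow> ?P (history \<alpha> (m * (t + 1) + 1))"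
    using survives_imp_strategy[of t ?P] by blast
  have "(1 / (2 * real t + 2) - \<epsilon>) * real n \<le> real (card {j \<in> {1..n}. \<alpha> (k + j) \<noteq> \<alpha> (k + n + j)})"
    if \<alpha>: "follows t \<sigma> \<alpha>" and n: "int n > int N" for \<alpha> k n
  proof -
    \<comment> \<open>Separation is known only at ends of rounds; \<open>k + 2 * n\<close> full
      rounds certainly cover both blocks.\<close>
    define h where "h = history \<alpha> ((k + 2 * n) * (t + 1) + 1)"
    have len: "k + 2 * n \<le> length h"
      unfolding h_def history_def length_map length_upt diff_add_inverse2 by simp
    have nth: "h ! i = \<alpha> (Suc i)" if "i < k + 2 * n" for i
    proof -
      have "i < length h" using that len by linarith
      then show ?thesis by (simp add: h_def history_def del: upt_Suc)
    qed
    have "(1 / (2 * real t + 2) - \<epsilon>) * real n \<le> c / real (t + 1) * real n"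
      using c_ge by (rule mult_right_mono) simp
    also have "\<dots> \<le> real (card {j \<in> {..<n}. h ! (k + j) \<noteq> h ! (k + n + j)})"
      using \<sigma>[OF \<alpha>, of "k + 2 * n"] len n unfolding separated_def h_def by auto
    also have "{j \<in> {..<n}. h ! (k + j) \<noteq> h ! (k + n + j)} =
        {j \<in> {..<n}. \<alpha> (k + Suc j) \<noteq> \<alpha> (k + n + Suc j)}"
      by (auto simp: nth)
    also have "card \<dots> = card {j \<in> {1..n}. \<alpha> (k + j) \<noteq> \<alpha> (k + n + j)}"
      by (rule card_shift)
    finally show ?thesis .
  qed
  then show "\<exists>N::int. \<exists>\<sigma>. ensures t \<sigma> (\<lambda>\<alpha>. \<forall>k n :: nat. int n > N \<longrightarrow>
      real (card {j \<in> {1..n}. \<alpha> (k + j) \<noteq> \<alpha> (k + n + j)})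
        \<ge> (1 / (2 * real t + 2) - \<epsilon>) * real n)"
    unfolding ensures_def by blast
qed

end
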